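(* Let $P$ be a configuration of $N=n+1$ points (pieces) in $\mathbf{R}^d$, numbered $0,1,\dots,n$, where piece $0$ initially sits at the origin but, like every other piece, is allowed to jump. Let $P$ also denote the $d\times n$ real matrix associated with it, whose $i$th column is the position of piece $i$ for $1\le i\le n$. Then $P$ can be transformed into a similar but larger configuration by a finite sequence of legal moves if and only if there is an $n\times n$ integer matrix $A$ with $|\det A|=1$ such that the configuration associated with the matrix $PA$ is similar to and larger than the initial configuration $P$.
   Context: A configuration of $n+1$ pieces in $\mathbf{R}^d$ is an $(n+1)$-tuple $(p_0,\dots,p_n)$ of points of $\mathbf{R}^d$, where $p_i$ is the position of piece $i$; several pieces are allowed to occupy the same point at the same time. A legal move chooses two different pieces $i\ne j$ in $\{0,\dots,n\}$ and replaces $p_i$ by $2p_j-p_i$ (piece $i$ jumps over piece $j$), leaving all other positions unchanged. The configuration associated with a real $d\times n$ matrix $Q$ is the one in which piece $0$ is at the origin and, for $1\le i\le n$, piece $i$ is at the $i$th column of $Q$. A configuration $(q_0,\dots,q_n)$ is similar to and larger than $(p_0,\dots,p_n)$ if there are a real number $\lambda$ with $|\lambda|>1$, an orthogonal $d\times d$ matrix $S$ and a vector $v\in\mathbf{R}^d$ such that $q_i=\lambda S p_i+v$ for all $i$. In particular, the configuration associated with a matrix $Q$ is similar to and larger than the one associated with $P$ if and only if $Q=\lambda SP$ for some real $\lambda$ with $|\lambda|>1$ and some orthogonal $d\times d$ matrix $S$. *)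

theory Defs
  imports Complex_Main "Jordan_Normal_Form.Determinant"
begin

text \<open>
  A configuration of n + 1 pieces is a function from piece numbers to vectors of which only the
  values at 0, ..., n are meaningful; no move affects any other value.
\<close>

type_synonym configuration = "nat \<Rightarrow> real vec"

definition legal_move :: "nat \<Rightarrow> configuration \<Rightarrow> configuration \<Rightarrow> bool" where
  "legal_move n p q \<longleftrightarrow>
     (\<exists>i j. i \<le> n \<and> j \<le> n \<and> i \<noteq> j \<and> q = p(i := 2 \<cdot>\<^sub>v p j - p i))"

text \<open>Columns are indexed from 0, so piece \<open>i \<ge> 1\<close> sits at column \<open>i - 1\<close>.\<close>

definition config_of_mat :: "real mat \<Rightarrow> configuration" where
  "config_of_mat Q i = (if i = 0 then 0\<^sub>v (dim_row Q) else col Q (i - 1))"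

text \<open>
  The library's \<open>orthogonal_mat\<close> only asks the columns to be nonzero and pairwise orthogonal,
  not of length 1, so it is not the notion needed here.
\<close>

definition orthonormal_mat :: "nat \<Rightarrow> real mat \<Rightarrow> bool" where
  "orthonormal_mat d S \<longleftrightarrow>
     S \<in> carrier_mat d d \<and> S\<^sup>T * S = 1\<^sub>m d \<and> S * S\<^sup>T = 1\<^sub>m d"

definition similar_larger :: "nat \<Rightarrow> nat \<Rightarrow> configuration \<Rightarrow> configuration \<Rightarrow> bool" where
  "similar_larger d n p q \<longleftrightarrow>
     (\<exists>c S v. \<bar>c\<bar> > 1 \<and> orthonormal_mat d S \<and> v \<in> carrier_vec d \<and>
        (\<forall>i\<le>n. q i = c \<cdot>\<^sub>v (S *\<^sub>v p i) + v))"

end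

theory Submission
  imports Defs
begin

text \<open>
  Relative to piece 0, a jump multiplies the matrix of positions on the right by an integral
  reflection congruent to the identity modulo 2, so every reachable configuration is a translate
  of the one associated with \<open>P A\<close> for some integral \<open>A\<close> with \<open>\<bar>det A\<bar> = 1\<close>.
  Conversely, \<open>P A = c S P\<close> gives \<open>P A\<^sup>m = c\<^sup>m S\<^sup>m P\<close>, and some positive power \<open>A\<^sup>m\<close> is
  congruent to the identity modulo 2. Such a matrix is a product of jump reflections: a Euclidean
  algorithm by sign changes and additions of even multiples of columns cannot stall, because in
  each row the diagonal entry is odd and the other ones are even, and hence brings it to
  lower triangular form with diagonal entries \<open>1\<close> or \<open>-1\<close>, whose even entries below the diagonal
  can then be cleared.
\<close>

section \<open>Jump matrices and their action on columns\<close>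

text \<open>Restores the zero column of piece 0, which the matrix omits, so that piece 0 and the
  columns obey the same formulas. Polymorphic because it serves both integral and real
  matrices.\<close>

definition piece_coord :: "'a::zero mat \<Rightarrow> nat \<Rightarrow> nat \<Rightarrow> 'a" where
  "piece_coord A r k = (if k = 0 then 0 else A $$ (r, k - 1))"

text \<open>
  The jump of piece \<open>i\<close> over piece \<open>j\<close> is \<open>1 + 2 x y\<^sup>T\<close>, where \<open>x = e\<^sub>j - e\<^sub>i\<close> and \<open>y\<close> is
  \<open>e\<^sub>i\<close> for \<open>i > 0\<close> and the all \<open>-1\<close> vector for \<open>i = 0\<close>, with \<open>e\<^sub>0 = 0\<close> and \<open>e\<^sub>k\<close> the unit
  vector of column \<open>k - 1\<close>.
\<close>

definition jump_mat :: "nat \<Rightarrow> nat \<Rightarrow> nat \<Rightarrow> 'a::comm_ring_1 mat" where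
  "jump_mat n i j = mat n n (\<lambda>(r, s). of_bool (r = s) +
     2 * (of_bool (j = Suc r) - of_bool (i = Suc r)) * (of_bool (i = Suc s) - of_bool (i = 0)))"

lemma jump_mat_carrier [simp]: "jump_mat n i j \<in> carrier_mat n n"
  by (simp add: jump_mat_def)

lemma sum_mult_of_bool_Suc:
  fixes A :: "'a::comm_ring_1 mat"
  assumes "k \<le> n"
  shows "(\<Sum>t<n. A $$ (r, t) * of_bool (k = Suc t)) = piece_coord A r k"
proof (cases k)
  case 0
  then show ?thesis by (simp add: piece_coord_def)
next
  case (Suc m)
  then have "(\<Sum>t<n. A $$ (r, t) * of_bool (k = Suc t)) = (\<Sum>t<n. if t = m then A $$ (r, t) else 0)"
    by (intro sum.cong) auto
  with Suc assms show ?thesis by (simp add: piece_coord_def)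
qed

text \<open>Multiplication by \<open>1 + 2 x y\<^sup>T\<close> adds
  \<open>2 (A x) y\<^sup>T\<close>, and \<open>A x\<close> is the position of piece \<open>j\<close>
  minus that of piece \<open>i\<close>. For \<open>i = 0\<close> every column gets the factor
  \<open>- 1\<close>, as all positions are measured from the piece that has moved.\<close>

lemma index_mult_jump_mat:
  fixes A :: "'a::comm_ring_1 mat"
  assumes A: "A \<in> carrier_mat m n" and rs: "r < m" "s < n" and ij: "i \<le> n" "j \<le> n"
  shows "(A * jump_mat n i j) $$ (r, s) = A $$ (r, s) +
    2 * (of_bool (i = Suc s) - of_bool (i = 0)) * (piece_coord A r j - piece_coord A r i)"
proof -
  let ?y = "of_bool (i = Suc s) - of_bool (i = 0) :: 'a"
  have "(A * jump_mat n i j) $$ (r, s) =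
    (\<Sum>t<n. A $$ (r, t) * (of_bool (t = s) +
       2 * (of_bool (j = Suc t) - of_bool (i = Suc t)) * ?y))"
    using A rs by (simp add: jump_mat_def scalar_prod_def lessThan_atLeast0)
  \<comment> \<open>The Kronecker delta is written with \<open>Suc\<close> so that all three sums
    have the form evaluated by \<open>sum_mult_of_bool_Suc\<close>.\<close>
  also have "\<dots> = (\<Sum>t<n. A $$ (r, t) * of_bool (Suc s = Suc t) +
       2 * ?y * (A $$ (r, t) * of_bool (j = Suc t) - A $$ (r, t) * of_bool (i = Suc t)))"
    by (intro sum.cong) (auto simp: algebra_simps)
  also have "\<dots> = (\<Sum>t<n. A $$ (r, t) * of_bool (Suc s = Suc t)) +
       2 * ?y * ((\<Sum>t<n. A $$ (r, t) * of_bool (j = Suc t)) - (\<Sum>t<n. A $$ (r, t) * of_bool (i = Suc t)))"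
    by (simp only: sum.distrib sum_distrib_left[symmetric] sum_subtractf)
  also have "\<dots> = piece_coord A r (Suc s) + 2 * ?y * (piece_coord A r j - piece_coord A r i)"
    using rs ij sum_mult_of_bool_Suc[of "Suc s" n A r] sum_mult_of_bool_Suc[of i n A r]
      sum_mult_of_bool_Suc[of j n A r] by (simp only: Suc_leI)
  finally show ?thesis by (simp add: piece_coord_def)
qed

lemma piece_coord_mult_jump_mat:
  fixes A :: "'a::comm_ring_1 mat"
  assumes "A \<in> carrier_mat m n" "r < m" "k \<le> n" "i \<le> n" "j \<le> n"
  shows "piece_coord (A * jump_mat n i j) r k = piece_coord A r k +
    2 * (of_bool (i = k) - of_bool (i = 0)) * (piece_coord A r j - piece_coord A r i)"
proof (cases k)
  case 0
  then show ?thesis by (simp add: piece_coord_def)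
next
  case (Suc s)
  with assms index_mult_jump_mat[OF assms(1,2), of s i j] show ?thesis
    by (simp add: piece_coord_def)
qed

text \<open>For \<open>i \<noteq> j\<close> one has \<open>y\<^sup>T x = - 1\<close>, so
  \<open>1 + 2 x y\<^sup>T\<close> is an involution: jumping back over the same piece undoes a
  jump.\<close>

lemma mult_jump_mat_twice:
  fixes A :: "'a::comm_ring_1 mat"
  assumes A: "A \<in> carrier_mat m n" and ij: "i \<le> n" "j \<le> n" "i \<noteq> j"
  shows "A * jump_mat n i j * jump_mat n i j = A"
proof (rule eq_matI)
  fix r s assume "r < dim_row A" "s < dim_col A"
  with A have rs: "r < m" "s < n" by auto
  have AG: "A * jump_mat n i j \<in> carrier_mat m n" using A by (rule mult_carrier_mat) simp
  show "(A * jump_mat n i j * jump_mat n i j) $$ (r, s) = A $$ (r, s)"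
    unfolding index_mult_jump_mat[OF AG rs ij(1,2)] index_mult_jump_mat[OF A rs ij(1,2)]
      piece_coord_mult_jump_mat[OF A rs(1) ij(2) ij(1,2)]
      piece_coord_mult_jump_mat[OF A rs(1) ij(1) ij(1,2)]
    using ij by (simp add: algebra_simps)
qed (use A in \<open>auto simp: jump_mat_def\<close>)

lemma abs_det_jump_mat:
  assumes "i \<le> n" "j \<le> n" "i \<noteq> j"
  shows "\<bar>det (jump_mat n i j :: int mat)\<bar> = 1"
proof -
  let ?G = "jump_mat n i j :: int mat"
  have "?G * ?G = 1\<^sub>m n"
    using mult_jump_mat_twice[OF one_carrier_mat[of n] assms, where 'a = int]
    by (simp add: left_mult_one_mat[OF jump_mat_carrier])
  then have "det ?G * det ?G = 1"
    by (metis det_mult det_one jump_mat_carrier)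
  then show ?thesis using zmult_eq_1_iff by fastforce
qed

lemma map_jump_mat: "map_mat real_of_int (jump_mat n i j) = jump_mat n i j"
  by (rule eq_matI) (auto simp: jump_mat_def)

lemma mult_map_mult_jump_mat:
  assumes "P \<in> carrier_mat d n" "A \<in> carrier_mat n n"
  shows "P * map_mat real_of_int (A * jump_mat n i j) = P * map_mat real_of_int A * jump_mat n i j"
proof -
  have "map_mat real_of_int (A * jump_mat n i j) = map_mat real_of_int A * jump_mat n i j"
    using of_int_hom.mat_hom_mult[OF assms(2) jump_mat_carrier, where 'a = real]
    by (simp add: map_jump_mat)
  then show ?thesis using assms by (simp add: assoc_mult_mat[of _ d n _ n _ n])
qed

section \<open>Reachable configurations relative to piece 0\<close>

lemma config_of_mat_carrier [simp]:
  "Q \<in> carrier_mat d n \<Longrightarrow> config_of_mat Q k \<in> carrier_vec d"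
  by (auto simp: config_of_mat_def)

lemma config_of_mat_index:
  "Q \<in> carrier_mat d n \<Longrightarrow> r < d \<Longrightarrow> k \<le> n \<Longrightarrow> config_of_mat Q k $ r = piece_coord Q r k"
  by (auto simp: config_of_mat_def piece_coord_def)

text \<open>Piece 0 may jump as well, so the invariant measures positions from its current place
  \<open>q 0\<close>. Each jump then multiplies the matrix by a jump matrix of determinant 1 or
  -1.\<close>

lemma reachable_relative_matrix:
  assumes "(legal_move n)\<^sup>*\<^sup>* (config_of_mat P) q" and P: "P \<in> carrier_mat d n"
  shows "\<exists>A :: int mat. A \<in> carrier_mat n n \<and> \<bar>det A\<bar> = 1 \<and>
    (\<forall>k\<le>n. q k \<in> carrier_vec d \<and> q k = config_of_mat (P * map_mat real_of_int A) k + q 0)"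
  using assms(1)
proof (induction rule: rtranclp_induct)
  case base
  have "P * map_mat real_of_int (1\<^sub>m n) = P"
    using P by (simp add: of_int_hom.mat_hom_one)
  moreover have "config_of_mat P k + config_of_mat P 0 = config_of_mat P k" for k
  proof -
    have "config_of_mat P 0 = 0\<^sub>v d" using P by (simp add: config_of_mat_def)
    then show ?thesis using right_zero_vec[OF config_of_mat_carrier[OF P, of k]] by simp
  qed
  ultimately show ?case using P by (intro exI[of _ "1\<^sub>m n"]) auto
next
  case (step p q)
  from step.IH obtain A :: "int mat" where A: "A \<in> carrier_mat n n" "\<bar>det A\<bar> = 1"
    and p: "\<And>k. k \<le> n \<Longrightarrow> p k \<in> carrier_vec d"
    and pA: "\<And>k. k \<le> n \<Longrightarrow> p k = config_of_mat (P * map_mat real_of_int A) k + p 0"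
    by blast
  from step.hyps obtain i j where ij: "i \<le> n" "j \<le> n" "i \<noteq> j"
    and q: "q = p(i := 2 \<cdot>\<^sub>v p j - p i)"
    unfolding legal_move_def by blast
  let ?Q = "P * map_mat real_of_int A"
  let ?B = "A * jump_mat n i j"
  have Q: "?Q \<in> carrier_mat d n" using P A by auto
  have QB: "P * map_mat real_of_int ?B = ?Q * jump_mat n i j"
    using mult_map_mult_jump_mat[OF P A(1)] .
  have QB_carrier: "?Q * jump_mat n i j \<in> carrier_mat d n" using Q by (rule mult_carrier_mat) simp
  have q_carrier: "q k \<in> carrier_vec d" if "k \<le> n" for k
    using that p ij by (auto simp: q)
  have q_index: "q k $ r = p k $ r + 2 * of_bool (i = k) * (p j $ r - p i $ r)"
    if "k \<le> n" "r < d" for k r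
    using that p[OF ij(1)] p[OF ij(2)] by (auto simp: q)
  have p_index: "p k $ r = piece_coord ?Q r k + p 0 $ r" if "k \<le> n" "r < d" for k r
  proof -
    have "p k $ r = (config_of_mat ?Q k + p 0) $ r" using pA[OF that(1)] by simp
    then show ?thesis using that p[of 0] config_of_mat_index[OF Q] by simp
  qed
  have "q k = config_of_mat (?Q * jump_mat n i j) k + q 0" if k: "k \<le> n" for k
  proof (rule eq_vecI)
    show "dim_vec (q k) = dim_vec (config_of_mat (?Q * jump_mat n i j) k + q 0)"
      using q_carrier[OF k] q_carrier[of 0] by simp
    fix r assume "r < dim_vec (config_of_mat (?Q * jump_mat n i j) k + q 0)"
    then have r: "r < d" using q_carrier[of 0] by simp
    have "(config_of_mat (?Q * jump_mat n i j) k + q 0) $ r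
        = piece_coord (?Q * jump_mat n i j) r k + q 0 $ r"
      using r k q_carrier[of 0] config_of_mat_index[OF QB_carrier r k] by simp
    also have "\<dots> = piece_coord ?Q r k +
        2 * (of_bool (i = k) - of_bool (i = 0)) * (piece_coord ?Q r j - piece_coord ?Q r i) + q 0 $ r"
      using piece_coord_mult_jump_mat[OF Q r k ij(1,2)] by simp
    \<comment> \<open>If piece 0 jumps, its displacement, contained in \<open>q 0\<close>, cancels
      the term with \<open>- of_bool (i = 0)\<close>; otherwise that term vanishes and
      \<open>q 0 = p 0\<close>.\<close>
    also have "\<dots> = q k $ r"
      using q_index[OF k r] q_index[of 0 r] p_index[OF k r] p_index[OF ij(1) r] p_index[OF ij(2) r] r
      by (simp add: algebra_simps)
    finally show "q k $ r = (config_of_mat (?Q * jump_mat n i j) k + q 0) $ r" by simp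
  qed
  moreover have "\<bar>det ?B\<bar> = 1"
    using det_mult[OF A(1) jump_mat_carrier[of n i j]] A(2) abs_det_jump_mat[OF ij]
    by (simp add: abs_mult)
  moreover have "?B \<in> carrier_mat n n" using A by auto
  ultimately show ?case using q_carrier QB by (intro exI[of _ ?B]) metis
qed

section \<open>Column operations produced by jumps\<close>

text \<open>Only pieces other than piece 0 jump here, so the origin stays occupied by piece 0 and no
  translation arises. The value \<open>j = 0\<close> is a jump over the origin.\<close>

definition col_move :: "nat \<Rightarrow> int mat \<Rightarrow> int mat \<Rightarrow> bool" where
  "col_move n A B \<longleftrightarrow> A \<in> carrier_mat n n \<and>
     (\<exists>i j. i < n \<and> j \<le> n \<and> Suc i \<noteq> j \<and> B = A * jump_mat n (Suc i) j)"

lemma col_move_sym: "col_move n A B \<Longrightarrow> col_move n B A"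
  unfolding col_move_def
  by (metis Suc_leI jump_mat_carrier mult_carrier_mat mult_jump_mat_twice)

lemma col_moves_sym: "(col_move n)\<^sup>*\<^sup>* A B \<Longrightarrow> (col_move n)\<^sup>*\<^sup>* B A"
  by (metis col_move_sym symp_def symp_rtranclp)

text \<open>The principal congruence subgroup of level 2 in GL_n(Z).\<close>

definition level_two :: "nat \<Rightarrow> int mat \<Rightarrow> bool" where
  "level_two n A \<longleftrightarrow> A \<in> carrier_mat n n \<and> \<bar>det A\<bar> = 1 \<and>
     (\<forall>r<n. \<forall>s<n. even (A $$ (r, s) - of_bool (r = s)))"

lemma col_move_level_two:
  assumes "col_move n A B" "level_two n A"
  shows "level_two n B"
proof -
  from assms(1) obtain i j where A: "A \<in> carrier_mat n n" and ij: "i < n" "j \<le> n" "Suc i \<noteq> j"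
    and B: "B = A * jump_mat n (Suc i) j"
    unfolding col_move_def by auto
  from ij have ij': "Suc i \<le> n" by simp
  have "\<bar>det B\<bar> = 1"
    using det_mult[OF A jump_mat_carrier[of n "Suc i" j]] assms(2) abs_det_jump_mat[OF ij' ij(2,3)]
    by (simp add: abs_mult B level_two_def)
  moreover have "even (B $$ (r, s) - of_bool (r = s))" if "r < n" "s < n" for r s
  proof -
    have "even (A $$ (r, s) - of_bool (r = s))" using assms(2) that by (simp add: level_two_def)
    then show ?thesis
      unfolding B index_mult_jump_mat[OF A that ij' ij(2)] by simp
  qed
  ultimately show ?thesis using A by (auto simp: level_two_def B)
qed

lemma col_moves_level_two:
  "(col_move n)\<^sup>*\<^sup>* A B \<Longrightarrow> level_two n A \<Longrightarrow> level_two n B"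
  by (induction rule: rtranclp_induct) (auto intro: col_move_level_two)

lemma col_move_multcol:
  assumes A: "A \<in> carrier_mat n n" and i: "i < n"
  shows "col_move n A (multcol i (- 1) A)"
proof -
  have "multcol i (- 1) A = A * jump_mat n (Suc i) 0"
  proof (rule eq_matI)
    fix r s assume "r < dim_row (A * jump_mat n (Suc i) 0)" "s < dim_col (A * jump_mat n (Suc i) 0)"
    then have rs: "r < n" "s < n" using A by (auto simp: jump_mat_def)
    show "multcol i (- 1) A $$ (r, s) = (A * jump_mat n (Suc i) 0) $$ (r, s)"
      using A i rs index_mult_jump_mat[OF A rs, of "Suc i" 0]
      by (auto simp: piece_coord_def)
  qed (use A in \<open>auto simp: jump_mat_def\<close>)
  then show ?thesis unfolding col_move_def using assms by blast
qed

text \<open>Two jumps suffice: column \<open>a\<close> first jumps over the origin to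
  \<open>- a\<close>, then over column \<open>b\<close> to
  \<open>2 b - (- a) = a + 2 b\<close>.\<close>

lemma col_moves_addcol_two:
  assumes A: "A \<in> carrier_mat n n" and ij: "i < n" "j < n" "i \<noteq> j"
  shows "(col_move n)\<^sup>*\<^sup>* A (addcol 2 i j A)"
proof -
  let ?B = "multcol i (- 1) A"
  have B: "?B \<in> carrier_mat n n" using A by (intro carrier_matI) auto
  have "addcol 2 i j A = ?B * jump_mat n (Suc i) (Suc j)"
  proof (rule eq_matI)
    fix r s assume "r < dim_row (?B * jump_mat n (Suc i) (Suc j))"
      "s < dim_col (?B * jump_mat n (Suc i) (Suc j))"
    then have rs: "r < n" "s < n" using A by (auto simp: jump_mat_def)
    show "addcol 2 i j A $$ (r, s) = (?B * jump_mat n (Suc i) (Suc j)) $$ (r, s)"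
      using A ij rs index_mult_jump_mat[OF B rs, of "Suc i" "Suc j"]
      by (auto simp: piece_coord_def)
  qed (use A in \<open>auto simp: jump_mat_def\<close>)
  then have "col_move n ?B (addcol 2 i j A)" unfolding col_move_def using B ij
    by (intro conjI exI[of _ i] exI[of _ "Suc j"]) auto
  then show ?thesis using col_move_multcol[OF A ij(1)]
    by (meson converse_rtranclp_into_rtranclp r_into_rtranclp)
qed

lemma col_moves_addcol_neg_two:
  assumes A: "A \<in> carrier_mat n n" and ij: "i < n" "j < n" "i \<noteq> j"
  shows "(col_move n)\<^sup>*\<^sup>* A (addcol (- 2) i j A)"
proof -
  let ?B = "addcol (- 2) i j A"
  have B: "?B \<in> carrier_mat n n" using A by (intro carrier_matI) auto
  have "addcol 2 i j ?B = A" using A ij by (intro eq_matI) auto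
  then show ?thesis using col_moves_sym[OF col_moves_addcol_two[OF B ij]] by simp
qed

lemma col_moves_addcol_even:
  assumes A: "A \<in> carrier_mat n n" and ij: "i < n" "j < n" "i \<noteq> j"
  shows "(col_move n)\<^sup>*\<^sup>* A (addcol (2 * t) i j A)"
proof (induction t rule: int_induct[where k = 0])
  case base
  have "addcol (2 * 0) i j A = A" using A by (intro eq_matI) auto
  then show ?case by simp
next
  case (step1 t)
  let ?B = "addcol (2 * t) i j A"
  have B: "?B \<in> carrier_mat n n" using A by (intro carrier_matI) auto
  have "addcol 2 i j ?B = addcol (2 * (t + 1)) i j A"
    using A ij by (intro eq_matI) (auto simp: algebra_simps)
  then show ?case using step1 col_moves_addcol_two[OF B ij] by simp
next
  case (step2 t)
  let ?B = "addcol (2 * t) i j A"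
  have B: "?B \<in> carrier_mat n n" using A by (intro carrier_matI) auto
  have "addcol (- 2) i j ?B = addcol (2 * (t - 1)) i j A"
    using A ij by (intro eq_matI) (auto simp: algebra_simps)
  then show ?case using step2 col_moves_addcol_neg_two[OF B ij] by simp
qed

section \<open>Euclidean reduction to lower triangular form\<close>

definition lower_upto :: "nat \<Rightarrow> nat \<Rightarrow> int mat \<Rightarrow> bool" where
  "lower_upto n k A \<longleftrightarrow> (\<forall>r s. r < k \<longrightarrow> r < s \<longrightarrow> s < n \<longrightarrow> A $$ (r, s) = 0)"

text \<open>With the sign of \<open>t\<close> chosen so that \<open>2 * t * b\<close> opposes
  \<open>a\<close>, the new absolute value is that of
  \<open>\<bar>a\<bar> - 2 * \<bar>b\<bar>\<close>, which lies strictly between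
  \<open>- \<bar>a\<bar>\<close> and \<open>\<bar>a\<bar>\<close>.\<close>

lemma ex_signed_double_less:
  fixes a b :: int
  assumes "\<bar>b\<bar> < \<bar>a\<bar>" "b \<noteq> 0"
  shows "\<exists>t. \<bar>2 * t * b + a\<bar> < \<bar>a\<bar>"
proof -
  have "\<bar>2 * 1 * b + a\<bar> < \<bar>a\<bar> \<or> \<bar>2 * (- 1) * b + a\<bar> < \<bar>a\<bar>" using assms by linarith
  then show ?thesis by blast
qed

text \<open>Descent on the sum of absolute values in row \<open>k\<close> from the diagonal on: as
  long as an entry right of the diagonal is nonzero, it or the diagonal entry can be made smaller by
  the other.\<close>

lemma reduce_row:
  assumes "level_two n A" "lower_upto n k A" "k < n"
  shows "\<exists>B. (col_move n)\<^sup>*\<^sup>* A B \<and> lower_upto n (Suc k) B"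
  using assms(1,2)
proof (induction "nat (\<Sum>s\<in>{k..<n}. \<bar>A $$ (k, s)\<bar>)" arbitrary: A rule: less_induct)
  case less
  have A: "A \<in> carrier_mat n n" using less.prems by (simp add: level_two_def)
  have reduce: ?case
    if ij: "i \<in> {k..<n}" "j \<in> {k..<n}" and lt: "\<bar>A $$ (k, j)\<bar> < \<bar>A $$ (k, i)\<bar>" and nz: "A $$ (k, j) \<noteq> 0"
    for i j
  proof -
    have ne: "i \<noteq> j" using lt by auto
    obtain t where t: "\<bar>2 * t * A $$ (k, j) + A $$ (k, i)\<bar> < \<bar>A $$ (k, i)\<bar>"
      using ex_signed_double_less[OF lt nz] by blast
    let ?B = "addcol (2 * t) i j A"
    have moves: "(col_move n)\<^sup>*\<^sup>* A ?B" using col_moves_addcol_even[OF A _ _ ne] ij by simp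
    have "(\<Sum>s\<in>{k..<n}. \<bar>?B $$ (k, s)\<bar>) < (\<Sum>s\<in>{k..<n}. \<bar>A $$ (k, s)\<bar>)"
    proof (rule sum_strict_mono_ex1)
      show "\<forall>s\<in>{k..<n}. \<bar>?B $$ (k, s)\<bar> \<le> \<bar>A $$ (k, s)\<bar>" using t A assms(3) by auto
      show "\<exists>s\<in>{k..<n}. \<bar>?B $$ (k, s)\<bar> < \<bar>A $$ (k, s)\<bar>"
        using t A ij assms(3) by (intro bexI[of _ i]) auto
    qed simp
    then have "nat (\<Sum>s\<in>{k..<n}. \<bar>?B $$ (k, s)\<bar>) < nat (\<Sum>s\<in>{k..<n}. \<bar>A $$ (k, s)\<bar>)"
      by (smt (verit) sum_nonneg zless_nat_conj abs_ge_zero)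
    moreover have "level_two n ?B" using col_moves_level_two[OF moves less.prems(1)] .
    \<comment> \<open>Both columns have index at least \<open>k\<close>, so they are zero in every
      row above row \<open>k\<close>.\<close>
    moreover have "lower_upto n k ?B"
      using less.prems(2) A ij assms(3) by (auto simp: lower_upto_def)
    ultimately obtain C where "(col_move n)\<^sup>*\<^sup>* ?B C" "lower_upto n (Suc k) C"
      using less.hyps by blast
    then show ?case using moves by (meson rtranclp_trans)
  qed
  have par: "even (A $$ (k, s) - of_bool (k = s))" if "s < n" for s
    using less.prems(1) assms(3) that by (simp add: level_two_def)
  have diag: "odd (A $$ (k, k))" using par[OF assms(3)] by simp
  show ?case
  proof (cases "\<exists>s. k < s \<and> s < n \<and> A $$ (k, s) \<noteq> 0")
    case True
    then obtain s where s: "k < s" "s < n" "A $$ (k, s) \<noteq> 0" by blast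
    then have ev: "even (A $$ (k, s))" using par[OF s(2)] by simp
    \<comment> \<open>An even and an odd entry cannot tie in absolute value, so one of them is
      strictly smaller and reduces the other; both orders can occur.\<close>
    then have "\<bar>A $$ (k, s)\<bar> \<noteq> \<bar>A $$ (k, k)\<bar>" using diag by (metis dvd_abs_iff)
    moreover have "A $$ (k, k) \<noteq> 0" using diag by auto
    ultimately show ?thesis using reduce[of s k] reduce[of k s] s assms(3) by force
  next
    case False
    then have "lower_upto n (Suc k) A"
      using less.prems(2) by (auto simp: lower_upto_def less_Suc_eq)
    then show ?thesis by blast
  qed
qed

lemma reduce_to_lower:
  assumes "level_two n A" "k \<le> n"
  shows "\<exists>B. (col_move n)\<^sup>*\<^sup>* A B \<and> lower_upto n k B"
  using assms(2)
proof (induction k)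
  case 0
  then show ?case by (auto simp: lower_upto_def)
next
  case (Suc k)
  then obtain B where B: "(col_move n)\<^sup>*\<^sup>* A B" "lower_upto n k B" by auto
  from reduce_row[OF col_moves_level_two[OF B(1) assms(1)] B(2)] Suc.prems
  obtain C where "(col_move n)\<^sup>*\<^sup>* B C" "lower_upto n (Suc k) C" by auto
  with B(1) show ?case by (meson rtranclp_trans)
qed

text \<open>The determinant is the product of the diagonal, so every diagonal entry divides a
  unit.\<close>

lemma abs_diag_lower:
  assumes "level_two n A" "lower_upto n n A" "r < n"
  shows "\<bar>A $$ (r, r)\<bar> = 1"
proof -
  have A: "A \<in> carrier_mat n n" "\<bar>det A\<bar> = 1" using assms(1) by (auto simp: level_two_def)
  have "det A = prod_list (diag_mat A)"
    using assms(2) by (intro det_lower_triangular[OF _ A(1)]) (auto simp: lower_upto_def)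
  moreover have "A $$ (r, r) \<in> set (diag_mat A)" using A(1) assms(3) by (auto simp: diag_mat_def)
  ultimately have "A $$ (r, r) dvd det A" by (simp add: prod_list_dvd)
  then show ?thesis using A(2) by (metis abs_dvd_iff dvd_abs_iff zdvd1_eq)
qed

section \<open>Clearing the entries below the diagonal\<close>

definition identity_rows :: "nat \<Rightarrow> nat \<Rightarrow> int mat \<Rightarrow> bool" where
  "identity_rows n k A \<longleftrightarrow> (\<forall>r s. r < k \<longrightarrow> s < n \<longrightarrow> A $$ (r, s) = of_bool (r = s))"

text \<open>After the diagonal entry is made 1, even multiples of column \<open>k\<close> clear the
  entries to its left. Column \<open>k\<close> is zero above row \<open>k\<close>, so the finished
  rows and the triangular shape survive.\<close>

lemma clear_row:
  assumes "level_two n A" "lower_upto n n A" "identity_rows n k A" "k < n"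
  shows "\<exists>B. (col_move n)\<^sup>*\<^sup>* A B \<and> lower_upto n n B \<and> identity_rows n (Suc k) B"
proof -
  \<comment> \<open>Induction on the number \<open>l\<close> of cleared entries; the base case only
    fixes the sign of the diagonal entry.\<close>
  have "\<exists>B. (col_move n)\<^sup>*\<^sup>* A B \<and> lower_upto n n B \<and> identity_rows n k B \<and>
      B $$ (k, k) = 1 \<and> (\<forall>s<l. B $$ (k, s) = 0)" if "l \<le> k" for l
    using that
  proof (induction l)
    case 0
    have A: "A \<in> carrier_mat n n" using assms(1) by (simp add: level_two_def)
    show ?case
    proof (cases "A $$ (k, k) = 1")
      case True
      then show ?thesis using assms by auto
    next
      case False
      then have "A $$ (k, k) = - 1" using abs_diag_lower[OF assms(1,2,4)] by linarith
      then show ?thesis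
        using A assms(2-4) col_move_multcol[OF A assms(4)]
        by (intro exI[of _ "multcol k (- 1) A"]) (auto simp: lower_upto_def identity_rows_def)
    qed
  next
    case (Suc l)
    then obtain B where B: "(col_move n)\<^sup>*\<^sup>* A B" "lower_upto n n B" "identity_rows n k B"
      "B $$ (k, k) = 1" "\<forall>s<l. B $$ (k, s) = 0" by auto
    have l: "l < k" "l < n" "l \<noteq> k" using Suc.prems assms(4) by auto
    have lB: "level_two n B" using col_moves_level_two[OF B(1) assms(1)] .
    then have Bc: "B \<in> carrier_mat n n" by (simp add: level_two_def)
    have "even (B $$ (k, l) - of_bool (k = l))" using lB l assms(4) unfolding level_two_def by blast
    then obtain t where t: "B $$ (k, l) = 2 * t" using l by auto
    \<comment> \<open>The pivot \<open>B $$ (k, k)\<close> is 1, so subtracting \<open>2 * t\<close>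
      times column \<open>k\<close> cancels the entry \<open>2 * t\<close> exactly.\<close>
    let ?C = "addcol (2 * (- t)) l k B"
    have moves: "(col_move n)\<^sup>*\<^sup>* A ?C"
      by (rule rtranclp_trans[OF B(1) col_moves_addcol_even[OF Bc l(2) assms(4) l(3)]])
    have C: "?C $$ (r, s) = (if l = s then B $$ (r, s) - 2 * t * B $$ (r, k) else B $$ (r, s))"
      if "r < n" "s < n" for r s
      using that Bc by simp
    have "lower_upto n n ?C"
      using B(2) C l assms(4) by (auto simp: lower_upto_def)
    moreover have "identity_rows n k ?C"
      using B(3) C l assms(4) by (auto simp: identity_rows_def)
    moreover have "?C $$ (k, k) = 1" using C B(4) l assms(4) by simp
    moreover have "\<forall>s<Suc l. ?C $$ (k, s) = 0"
      using C B(4,5) l assms(4) t by (auto simp: less_Suc_eq)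
    ultimately show ?case using moves by blast
  qed
  from this[of k] obtain B where B: "(col_move n)\<^sup>*\<^sup>* A B" "lower_upto n n B" "identity_rows n k B"
      "B $$ (k, k) = 1" "\<forall>s<k. B $$ (k, s) = 0" by auto
  have "B $$ (k, s) = of_bool (k = s)" if "s < n" for s
    using that B(2,4,5) assms(4) by (cases s k rule: linorder_cases) (auto simp: lower_upto_def)
  then have "identity_rows n (Suc k) B"
    using B(3) by (auto simp: identity_rows_def less_Suc_eq)
  with B show ?thesis by blast
qed

text \<open>Triangular form is reached first, then rows are cleared from the top down. As moves are
  reversible, this says that jumps of the pieces other than piece 0 generate the level-two
  group.\<close>

lemma level_two_col_moves_one:
  assumes "level_two n A"
  shows "(col_move n)\<^sup>*\<^sup>* A (1\<^sub>m n)"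
proof -
  obtain B where B: "(col_move n)\<^sup>*\<^sup>* A B" "lower_upto n n B"
    using reduce_to_lower[OF assms] by auto
  have "\<exists>C. (col_move n)\<^sup>*\<^sup>* A C \<and> lower_upto n n C \<and> identity_rows n k C" if "k \<le> n" for k
    using that
  proof (induction k)
    case 0
    then show ?case using B by (auto simp: identity_rows_def)
  next
    case (Suc k)
    then obtain C where C: "(col_move n)\<^sup>*\<^sup>* A C" "lower_upto n n C" "identity_rows n k C" by auto
    from clear_row[OF col_moves_level_two[OF C(1) assms] C(2,3)] Suc.prems
    obtain D where "(col_move n)\<^sup>*\<^sup>* C D" "lower_upto n n D" "identity_rows n (Suc k) D" by auto
    with C(1) show ?case by (meson rtranclp_trans)
  qed
  from this[of n] obtain C where C: "(col_move n)\<^sup>*\<^sup>* A C" "identity_rows n n C" by auto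
  have "C \<in> carrier_mat n n" using col_moves_level_two[OF C(1) assms] by (simp add: level_two_def)
  then have "C = 1\<^sub>m n" using C(2) by (intro eq_matI) (auto simp: identity_rows_def)
  with C(1) show ?thesis by simp
qed

section \<open>Column operations realized by legal moves\<close>

text \<open>
  The two configurations agree only on the pieces \<open>0, \<dots>, n\<close>: beyond them \<open>config_of_mat\<close> reads
  columns outside the matrix, whose values a move need not preserve.
\<close>

lemma col_moves_legal_moves:
  assumes "(col_move n)\<^sup>*\<^sup>* (1\<^sub>m n) A" and P: "P \<in> carrier_mat d n"
  shows "\<exists>q. (legal_move n)\<^sup>*\<^sup>* (config_of_mat P) q \<and>
    (\<forall>k\<le>n. q k = config_of_mat (P * map_mat real_of_int A) k)"
  using assms(1)
proof (induction rule: rtranclp_induct)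
  case base
  have "P * map_mat real_of_int (1\<^sub>m n) = P"
    using P by (simp add: of_int_hom.mat_hom_one)
  then show ?case by auto
next
  case (step A B)
  then obtain p where p: "(legal_move n)\<^sup>*\<^sup>* (config_of_mat P) p"
    "\<And>k. k \<le> n \<Longrightarrow> p k = config_of_mat (P * map_mat real_of_int A) k" by auto
  from step.hyps(2) obtain i j where A: "A \<in> carrier_mat n n" and ij: "Suc i \<le> n" "j \<le> n" "Suc i \<noteq> j"
    and B: "B = A * jump_mat n (Suc i) j"
    unfolding col_move_def by (auto simp: Suc_le_eq)
  let ?Q = "P * map_mat real_of_int A"
  have Q: "?Q \<in> carrier_mat d n" using P A by auto
  have QB: "P * map_mat real_of_int B = ?Q * jump_mat n (Suc i) j"
    unfolding B using mult_map_mult_jump_mat[OF P A(1)] .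
  have QB_carrier: "?Q * jump_mat n (Suc i) j \<in> carrier_mat d n"
    using Q by (rule mult_carrier_mat) simp
  let ?q = "p(Suc i := 2 \<cdot>\<^sub>v p j - p (Suc i))"
  have "?q k = config_of_mat (?Q * jump_mat n (Suc i) j) k" if k: "k \<le> n" for k
  proof (rule eq_vecI)
    have dims: "dim_vec (config_of_mat ?Q l) = d" "dim_vec (config_of_mat (?Q * jump_mat n (Suc i) j) l) = d" for l
      using config_of_mat_carrier[OF Q, of l] config_of_mat_carrier[OF QB_carrier, of l]
      by (simp_all del: config_of_mat_carrier)
    show "dim_vec (?q k) = dim_vec (config_of_mat (?Q * jump_mat n (Suc i) j) k)"
      using p(2) k ij by (auto simp: dims)
    fix r assume "r < dim_vec (config_of_mat (?Q * jump_mat n (Suc i) j) k)"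
    then have r: "r < d" by (simp add: dims)
    show "?q k $ r = config_of_mat (?Q * jump_mat n (Suc i) j) k $ r"
      unfolding config_of_mat_index[OF QB_carrier r k] piece_coord_mult_jump_mat[OF Q r k ij(1,2)]
      using p(2) ij k r by (auto simp: dims config_of_mat_index[OF Q r])
  qed
  moreover have "legal_move n p ?q" unfolding legal_move_def using ij by blast
  then have "(legal_move n)\<^sup>*\<^sup>* (config_of_mat P) ?q"
    by (rule rtranclp.rtrancl_into_rtrancl[OF p(1)])
  ultimately show ?case unfolding QB by blast
qed

section \<open>A power congruent to the identity modulo 2\<close>

lemma index_mult_mat_sum:
  assumes "X \<in> carrier_mat m n" "Y \<in> carrier_mat n l" "r < m" "s < l"
  shows "(X * Y) $$ (r, s) = (\<Sum>t<n. X $$ (r, t) * Y $$ (t, s))"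
  using assms by (simp add: scalar_prod_def lessThan_atLeast0)

text \<open>A matrix of odd determinant is invertible modulo 2. Multiplying by the adjugate keeps
  everything integral and leaves only the odd factor \<open>det A\<close>.\<close>

lemma even_cancel_mult:
  fixes A B X Y :: "int mat"
  assumes A: "A \<in> carrier_mat n n" "\<bar>det A\<bar> = 1" and X: "X \<in> carrier_mat n n" and Y: "Y \<in> carrier_mat n n"
    and ev: "\<And>r s. r < n \<Longrightarrow> s < n \<Longrightarrow> even ((X * A) $$ (r, s) - (Y * A) $$ (r, s))"
    and rs: "r < n" "s < n"
  shows "even (X $$ (r, s) - Y $$ (r, s))"
proof -
  let ?B = "adj_mat A"
  have B: "?B \<in> carrier_mat n n" "A * ?B = det A \<cdot>\<^sub>m 1\<^sub>m n" using adj_mat[OF A(1)] by auto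
  have Z: "(Z * A * ?B) $$ (r, s) = det A * Z $$ (r, s)" if "Z \<in> carrier_mat n n" for Z
  proof -
    have "Z * A * ?B = det A \<cdot>\<^sub>m Z"
      using assoc_mult_mat[OF that A(1) B(1)] mult_smult_distrib[OF that one_carrier_mat, of "det A"] B(2) that
      by simp
    then show ?thesis using that rs by simp
  qed
  have mul: "(Z * A * ?B) $$ (r, s) = (\<Sum>t<n. (Z * A) $$ (r, t) * ?B $$ (t, s))"
    if "Z \<in> carrier_mat n n" for Z
    by (rule index_mult_mat_sum[OF mult_carrier_mat[OF that A(1)] B(1) rs])
  have "det A * (X $$ (r, s) - Y $$ (r, s))
      = (\<Sum>t<n. ((X * A) $$ (r, t) - (Y * A) $$ (r, t)) * ?B $$ (t, s))"
    using mul[OF X] mul[OF Y] Z[OF X] Z[OF Y]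
    by (simp add: right_diff_distrib left_diff_distrib sum_subtractf)
  moreover have "even \<dots>" using ev rs by (intro dvd_sum dvd_mult2) auto
  ultimately have "even (det A * (X $$ (r, s) - Y $$ (r, s)))" by simp
  moreover have "odd (det A)" using A(2) by (metis dvd_abs_iff odd_one)
  ultimately show ?thesis by simp
qed

text \<open>Pigeonhole: there are finitely many parity patterns, so two powers of \<open>A\<close>
  agree modulo 2, and the lower one can be cancelled.\<close>

lemma ex_level_two_pow:
  fixes A :: "int mat"
  assumes A: "A \<in> carrier_mat n n" "\<bar>det A\<bar> = 1"
  shows "\<exists>m>0. level_two n (A ^\<^sub>m m)"
proof -
  \<comment> \<open>The parity pattern of a power, encoded as the set of its odd positions.\<close>
  define f where "f k = {(r, s). r < n \<and> s < n \<and> odd ((A ^\<^sub>m k) $$ (r, s))}" for k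
  have Ak: "A ^\<^sub>m k \<in> carrier_mat n n" for k using A(1) by simp
  have "range f \<subseteq> Pow ({..<n} \<times> {..<n})" by (auto simp: f_def)
  then have "finite (range f)" by (rule finite_subset) simp
  then have "\<not> inj f" using finite_imageD infinite_UNIV_nat by blast
  then obtain a b where "a < b" and ab: "f a = f b"
    unfolding inj_def by (metis linorder_neqE_nat)
  then obtain m where m: "b = a + m" "m > 0" using less_imp_add_positive by blast
  have "odd ((A ^\<^sub>m a) $$ (r, s)) = odd ((A ^\<^sub>m (a + m)) $$ (r, s))" if "r < n" "s < n" for r s
    using ab that unfolding m f_def set_eq_iff by auto
  then have "even ((A ^\<^sub>m (a + m)) $$ (r, s) - (A ^\<^sub>m a) $$ (r, s))" if "r < n" "s < n" for r s
    using that by simp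
  \<comment> \<open>Factors \<open>A\<close> are cancelled one at a time by induction on
    \<open>a\<close>; what remains compares \<open>A ^\<^sub>m m\<close> with the identity
    \<open>A ^\<^sub>m 0\<close>.\<close>
  then have "even ((A ^\<^sub>m (0 + m)) $$ (r, s) - (A ^\<^sub>m 0) $$ (r, s))" if "r < n" "s < n" for r s
    using that
  proof (induction a arbitrary: r s)
    case 0
    then show ?case .
  next
    case (Suc a)
    have "even ((A ^\<^sub>m (a + m)) $$ (r, s) - (A ^\<^sub>m a) $$ (r, s))" if "r < n" "s < n" for r s
    proof (rule even_cancel_mult[OF A Ak Ak _ that])
      fix r s assume "r < n" "s < n"
      then show "even ((A ^\<^sub>m (a + m) * A) $$ (r, s) - (A ^\<^sub>m a * A) $$ (r, s))"
        using Suc.prems(1)[of r s] by (simp only: add_Suc pow_mat.simps)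
    qed
    then show ?case by (rule Suc.IH[OF _ Suc.prems(2,3)])
  qed
  moreover have "\<bar>det (A ^\<^sub>m k)\<bar> = 1" for k
    using A det_mult[OF Ak A(1)] by (induction k) (auto simp: abs_mult)
  ultimately have "level_two n (A ^\<^sub>m m)" using A(1) Ak[of m] by (auto simp: level_two_def)
  then show ?thesis using m by blast
qed

section \<open>Similarities and powers\<close>

lemma orthonormal_mat_mult:
  assumes "orthonormal_mat d S" "orthonormal_mat d T"
  shows "orthonormal_mat d (S * T)"
proof -
  have S: "S \<in> carrier_mat d d" "S\<^sup>T * S = 1\<^sub>m d" "S * S\<^sup>T = 1\<^sub>m d"
    and T: "T \<in> carrier_mat d d" "T\<^sup>T * T = 1\<^sub>m d" "T * T\<^sup>T = 1\<^sub>m d"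
    using assms by (auto simp: orthonormal_mat_def)
  have tr: "(S * T)\<^sup>T = T\<^sup>T * S\<^sup>T" using transpose_mult[OF S(1) T(1)] .
  have "T\<^sup>T * S\<^sup>T * (S * T) = T\<^sup>T * (S\<^sup>T * S * T)"
    using S(1) T(1) by (simp add: assoc_mult_mat[of _ d d _ d _ d])
  also have "\<dots> = 1\<^sub>m d" using S T by simp
  finally have 1: "T\<^sup>T * S\<^sup>T * (S * T) = 1\<^sub>m d" .
  have "S * T * (T\<^sup>T * S\<^sup>T) = S * (T * T\<^sup>T * S\<^sup>T)"
    using S(1) T(1) by (simp add: assoc_mult_mat[of _ d d _ d _ d])
  also have "\<dots> = 1\<^sub>m d" using S T by simp
  finally show ?thesis using 1 S(1) T(1) by (simp add: orthonormal_mat_def tr)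
qed

lemma smult_mult_mat_zero_vec:
  fixes S :: "real mat"
  assumes "S \<in> carrier_mat m d"
  shows "c \<cdot>\<^sub>v (S *\<^sub>v 0\<^sub>v d) = 0\<^sub>v m"
  using assms by (intro eq_vecI) (auto intro!: scalar_prod_right_zero)

text \<open>Piece 0 is at the origin in both configurations, which forces the translation to be
  zero; the other pieces give the matrix equation column by column.\<close>

lemma similar_larger_config_of_mat_iff:
  assumes P: "P \<in> carrier_mat d n" and Q: "Q \<in> carrier_mat d n"
  shows "similar_larger d n (config_of_mat P) (config_of_mat Q) \<longleftrightarrow>
    (\<exists>c S. \<bar>c\<bar> > 1 \<and> orthonormal_mat d S \<and> Q = c \<cdot>\<^sub>m (S * P))"
proof
  assume "similar_larger d n (config_of_mat P) (config_of_mat Q)"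
  then obtain c S v where c: "\<bar>c\<bar> > 1" and S: "orthonormal_mat d S" and v: "v \<in> carrier_vec d"
    and eq: "\<And>k. k \<le> n \<Longrightarrow> config_of_mat Q k = c \<cdot>\<^sub>v (S *\<^sub>v config_of_mat P k) + v"
    unfolding similar_larger_def by blast
  have Sc: "S \<in> carrier_mat d d" using S by (simp add: orthonormal_mat_def)
  have "v = 0\<^sub>v d"
    using eq[of 0] P Q v by (simp add: config_of_mat_def smult_mult_mat_zero_vec[OF Sc])
  then have "col Q s = c \<cdot>\<^sub>v (S *\<^sub>v col P s)" if "s < n" for s
    using eq[of "Suc s"] that Sc P by (simp add: config_of_mat_def)
  then have "Q = c \<cdot>\<^sub>m (S * P)"
    using P Q Sc by (intro mat_col_eqI) (auto simp: col_mult2[of _ d d _ n])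
  with c S show "\<exists>c S. \<bar>c\<bar> > 1 \<and> orthonormal_mat d S \<and> Q = c \<cdot>\<^sub>m (S * P)" by blast
next
  assume "\<exists>c S. \<bar>c\<bar> > 1 \<and> orthonormal_mat d S \<and> Q = c \<cdot>\<^sub>m (S * P)"
  then obtain c S where c: "\<bar>c\<bar> > 1" and S: "orthonormal_mat d S" and eq: "Q = c \<cdot>\<^sub>m (S * P)" by blast
  have Sc: "S \<in> carrier_mat d d" using S by (simp add: orthonormal_mat_def)
  have "config_of_mat Q k = c \<cdot>\<^sub>v (S *\<^sub>v config_of_mat P k) + 0\<^sub>v d" if "k \<le> n" for k
    using that P Sc by (auto simp: config_of_mat_def eq col_mult2[of _ d d _ n])
  then show "similar_larger d n (config_of_mat P) (config_of_mat Q)"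
    unfolding similar_larger_def using c S by (metis zero_carrier_vec)
qed

lemma add_right_imp_eq_vec:
  fixes x y v :: "'a::cancel_semigroup_add vec"
  assumes "x \<in> carrier_vec d" "y \<in> carrier_vec d" "v \<in> carrier_vec d" and eq: "x + v = y + v"
  shows "x = y"
proof (rule eq_vecI)
  fix i assume "i < dim_vec y"
  moreover have "(x + v) $ i = (y + v) $ i" using eq by simp
  ultimately show "x $ i = y $ i" using assms(1-3) by simp
qed (use assms in auto)

lemma smult_smult_mat:
  fixes A :: "'a::semigroup_mult mat"
  shows "a \<cdot>\<^sub>m (b \<cdot>\<^sub>m A) = (a * b) \<cdot>\<^sub>m A"
  by (intro eq_matI) (auto simp: mult.assoc)

text \<open>The similarity acts on the left and \<open>A\<close> on the right, so each further
  factor \<open>A\<close> contributes another \<open>c\<close> and another \<open>S\<close>: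
  \<open>c\<^sup>k T (P A) = c\<^sup>k T (c S P)\<close>.\<close>

lemma mult_pow_similar:
  assumes P: "P \<in> carrier_mat d n" and A: "A \<in> carrier_mat n n"
    and S: "orthonormal_mat d S" and PA: "P * A = c \<cdot>\<^sub>m (S * P)"
  shows "\<exists>T. orthonormal_mat d T \<and> P * A ^\<^sub>m Suc m = c ^ Suc m \<cdot>\<^sub>m (T * P)"
proof (induction m)
  case 0
  have "P * A ^\<^sub>m Suc 0 = P * A" using A by simp
  then show ?case using S PA by auto
next
  case (Suc m)
  then obtain T where T: "orthonormal_mat d T" "P * A ^\<^sub>m Suc m = c ^ Suc m \<cdot>\<^sub>m (T * P)" by blast
  have carr: "S \<in> carrier_mat d d" "T \<in> carrier_mat d d" using S T by (auto simp: orthonormal_mat_def)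
  have Am: "A ^\<^sub>m Suc m \<in> carrier_mat n n" using A by (rule pow_carrier_mat)
  have "P * A ^\<^sub>m Suc (Suc m) = P * A ^\<^sub>m Suc m * A"
    using assoc_mult_mat[OF P Am A] by simp
  also have "\<dots> = c ^ Suc m \<cdot>\<^sub>m (T * (P * A))"
    unfolding T(2) using carr P A by (simp add: mult_smult_assoc_mat[of _ d n] assoc_mult_mat[of _ d d _ n _ n])
  also have "\<dots> = c ^ Suc (Suc m) \<cdot>\<^sub>m (T * S * P)"
    unfolding PA using carr P by (simp add: mult_smult_distrib[of _ d d _ n] assoc_mult_mat[of _ d d _ d _ n] smult_smult_mat mult_ac)
  finally show ?case using orthonormal_mat_mult[OF T(1) S] by blast
qed

theorem theorem1p2:
  fixes d n :: nat and P :: "real mat"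
  assumes "P \<in> carrier_mat d n"
  shows "(\<exists>q. (legal_move n)\<^sup>*\<^sup>* (config_of_mat P) q \<and> similar_larger d n (config_of_mat P) q) \<longleftrightarrow>
         (\<exists>A :: int mat. A \<in> carrier_mat n n \<and> \<bar>det A\<bar> = 1 \<and>
            similar_larger d n (config_of_mat P) (config_of_mat (P * map_mat real_of_int A)))"
proof
  assume "\<exists>q. (legal_move n)\<^sup>*\<^sup>* (config_of_mat P) q \<and> similar_larger d n (config_of_mat P) q"
  then obtain q c S v where q: "(legal_move n)\<^sup>*\<^sup>* (config_of_mat P) q"
    and c: "\<bar>c\<bar> > 1" and S: "orthonormal_mat d S" and v: "v \<in> carrier_vec d"
    and sim: "\<And>k. k \<le> n \<Longrightarrow> q k = c \<cdot>\<^sub>v (S *\<^sub>v config_of_mat P k) + v"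
    unfolding similar_larger_def by blast
  obtain A :: "int mat" where A: "A \<in> carrier_mat n n" "\<bar>det A\<bar> = 1"
    and qA: "\<And>k. k \<le> n \<Longrightarrow> q k = config_of_mat (P * map_mat real_of_int A) k + q 0"
    using reachable_relative_matrix[OF q assms] by blast
  have Sc: "S \<in> carrier_mat d d" using S by (simp add: orthonormal_mat_def)
  have Q: "P * map_mat real_of_int A \<in> carrier_mat d n" using assms A by auto
  \<comment> \<open>Piece 0 starts at the origin, so the translation of the similarity is its final
    position, the same vector that relates \<open>q\<close> to the matrix.\<close>
  have q0: "q 0 = v" using sim[of 0] assms v by (simp add: config_of_mat_def smult_mult_mat_zero_vec[OF Sc])
  have "config_of_mat (P * map_mat real_of_int A) k = c \<cdot>\<^sub>v (S *\<^sub>v config_of_mat P k) + 0\<^sub>v d"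
    if k: "k \<le> n" for k
  proof -
    have x: "config_of_mat (P * map_mat real_of_int A) k \<in> carrier_vec d" using Q by simp
    have y: "c \<cdot>\<^sub>v (S *\<^sub>v config_of_mat P k) \<in> carrier_vec d"
      using Sc assms by (metis mult_mat_vec_carrier smult_carrier_vec config_of_mat_carrier)
    have "config_of_mat (P * map_mat real_of_int A) k + v = c \<cdot>\<^sub>v (S *\<^sub>v config_of_mat P k) + v"
      using qA[OF k] sim[OF k] q0 by simp
    then have "config_of_mat (P * map_mat real_of_int A) k = c \<cdot>\<^sub>v (S *\<^sub>v config_of_mat P k)"
      by (rule add_right_imp_eq_vec[OF x y v])
    then show ?thesis using y by simp
  qed
  then have "similar_larger d n (config_of_mat P) (config_of_mat (P * map_mat real_of_int A))"
    unfolding similar_larger_def using c S by (metis zero_carrier_vec)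
  with A show "\<exists>A :: int mat. A \<in> carrier_mat n n \<and> \<bar>det A\<bar> = 1 \<and>
      similar_larger d n (config_of_mat P) (config_of_mat (P * map_mat real_of_int A))" by blast
next
  assume "\<exists>A :: int mat. A \<in> carrier_mat n n \<and> \<bar>det A\<bar> = 1 \<and>
      similar_larger d n (config_of_mat P) (config_of_mat (P * map_mat real_of_int A))"
  then obtain A :: "int mat" where A: "A \<in> carrier_mat n n" "\<bar>det A\<bar> = 1"
    and sim: "similar_larger d n (config_of_mat P) (config_of_mat (P * map_mat real_of_int A))" by blast
  let ?R = "map_mat real_of_int A"
  have R: "?R \<in> carrier_mat n n" using A by simp
  obtain c S where c: "\<bar>c\<bar> > 1" and S: "orthonormal_mat d S" and PR: "P * ?R = c \<cdot>\<^sub>m (S * P)"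
    using sim similar_larger_config_of_mat_iff[OF assms mult_carrier_mat[OF assms R]] by blast
  \<comment> \<open>\<open>A\<close> itself need not be congruent to the identity modulo 2, so the
    configuration actually reached is that of \<open>P A\<^sup>m\<close>, scaled by
    \<open>c\<^sup>m\<close>.\<close>
  obtain m where "m > 0" and lev: "level_two n (A ^\<^sub>m m)" using ex_level_two_pow[OF A] by blast
  then obtain m' where m: "m = Suc m'" using gr0_implies_Suc by blast
  obtain T where T: "orthonormal_mat d T" "P * ?R ^\<^sub>m m = c ^ m \<cdot>\<^sub>m (T * P)"
    using mult_pow_similar[OF assms R S PR, of m'] unfolding m by blast
  have Rm: "map_mat real_of_int (A ^\<^sub>m m) = ?R ^\<^sub>m m"
    using of_int_hom.mat_hom_pow[OF A(1)] .
  have "\<bar>c ^ m\<bar> > 1" using c \<open>m > 0\<close> by (simp add: power_abs one_less_power)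
  then have "similar_larger d n (config_of_mat P) (config_of_mat (P * ?R ^\<^sub>m m))"
    using similar_larger_config_of_mat_iff[OF assms mult_carrier_mat[OF assms pow_carrier_mat[OF R]]] T
    by blast
  moreover obtain q where "(legal_move n)\<^sup>*\<^sup>* (config_of_mat P) q"
    "\<And>k. k \<le> n \<Longrightarrow> q k = config_of_mat (P * ?R ^\<^sub>m m) k"
    using col_moves_legal_moves[OF col_moves_sym[OF level_two_col_moves_one[OF lev]] assms]
    unfolding Rm by blast
  \<comment> \<open>Similarity reads only the pieces \<open>0, \<dots>, n\<close>, where
    \<open>q\<close> agrees with the configuration of the matrix.\<close>
  ultimately show "\<exists>q. (legal_move n)\<^sup>*\<^sup>* (config_of_mat P) q \<and> similar_larger d n (config_of_mat P) q"
    unfolding similar_larger_def by metis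
qed

end
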